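(* Let $\mathcal{R}$ be a ring with unity, let $b,c\in\mathcal{R}$ be regular, and let $a\in\mathcal{R}$, $g\in b\{1\}$ and $h\in c\{1\}$. Then the following conditions are equivalent. (i) $a$ is $(b,c)$-invertible. (ii) There exists $z\in b\mathcal{R}c$ such that $$bg=zhcabg,\qquad hc=hcabgz.$$ Furthermore, in this case $z=a^{-(b,c)}$.
   Context: An element $x$ of a ring $\mathcal{R}$ with unity is regular if there is $w\in\mathcal{R}$ with $x=xwx$; $x\{1\}$ denotes the set of all such $w$ (inner inverses of $x$). Also $b\mathcal{R}c=\{brc: r\in\mathcal{R}\}$. Given $b,c\in\mathcal{R}$, an element $a\in\mathcal{R}$ is $(b,c)$-invertible if there is $y\in\mathcal{R}$ with $y\in(b\mathcal{R}y)\cap(y\mathcal{R}c)$, $b=yab$ and $c=cay$. Such a $y$ is unique if it exists; it is denoted $a^{-(b,c)}$. *)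

theory Defs
  imports Main
begin

text \<open>
  The sort \<open>{ring, monoid_mult}\<close> is that of associative, not necessarily commutative rings
  with unity. Unlike \<open>ring_1\<close>, it does not require \<open>0 \<noteq> 1\<close>, so the zero ring is included.
\<close>

definition inner_inverses :: "'a::{ring,monoid_mult} \<Rightarrow> 'a set" where
  "inner_inverses x = {w. x = x * w * x}"

definition regular :: "'a::{ring,monoid_mult} \<Rightarrow> bool" where
  "regular x \<longleftrightarrow> (\<exists>w. x = x * w * x)"

text \<open>The set \<open>b R c\<close>, where \<open>R\<close> is the whole ring, i.e. the type \<open>'a\<close>.\<close>

definition sandwich :: "'a::{ring,monoid_mult} \<Rightarrow> 'a \<Rightarrow> 'a set" where
  "sandwich b c = {b * r * c | r. True}"

definition is_bc_inverse :: "'a::{ring,monoid_mult} \<Rightarrow> 'a \<Rightarrow> 'a \<Rightarrow> 'a \<Rightarrow> bool" where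
  "is_bc_inverse b c a y \<longleftrightarrow>
     y \<in> sandwich b y \<inter> sandwich y c \<and> b = y * a * b \<and> c = c * a * y"

definition bc_invertible :: "'a::{ring,monoid_mult} \<Rightarrow> 'a \<Rightarrow> 'a \<Rightarrow> bool" where
  "bc_invertible b c a \<longleftrightarrow> (\<exists>y. is_bc_inverse b c a y)"

text \<open>Only meaningful when \<open>bc_invertible b c a\<close> holds.\<close>

definition bc_inverse :: "'a::{ring,monoid_mult} \<Rightarrow> 'a \<Rightarrow> 'a \<Rightarrow> 'a" where
  "bc_inverse b c a = (THE y. is_bc_inverse b c a y)"

lemma is_bc_inverse_unique:
  assumes x: "is_bc_inverse b c a x" and y: "is_bc_inverse b c a y"
  shows "x = y"
proof -
  obtain s where s: "x = b * s * x"
    using x by (auto simp: is_bc_inverse_def sandwich_def)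
  obtain r where r: "y = y * r * c"
    using y by (auto simp: is_bc_inverse_def sandwich_def)
  have b: "b = y * a * b" and c: "c = c * a * x"
    using x y by (auto simp: is_bc_inverse_def)
  have "x = y * a * b * s * x" using s b by simp
  also have "\<dots> = y * a * x" using s by (simp add: mult.assoc)
  also have "\<dots> = y * r * (c * a * x)" using r by (simp add: mult.assoc[symmetric])
  also have "\<dots> = y" using r c by simp
  finally show ?thesis .
qed

lemma bc_inverse_eqI: "is_bc_inverse b c a y \<Longrightarrow> bc_inverse b c a = y"
  unfolding bc_inverse_def by (blast intro: is_bc_inverse_unique)

end

theory Submission imports Defs begin

text \<open>
  Any \<open>z = b r c\<close> absorbs the idempotents \<open>b g\<close> and \<open>h c\<close>, that is \<open>b g z = z = z h c\<close>. The two
  equations of (ii) therefore read \<open>b g = z a b g\<close> and \<open>h c = h c a z\<close>; cancelling \<open>g\<close> and \<open>h\<close> by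
  multiplying with \<open>b\<close> on the right and \<open>c\<close> on the left turns them into \<open>b = z a b\<close> and
  \<open>c = c a z\<close>.
\<close>

text \<open>Substituting \<open>y = y * r * c\<close> for the last factor of
  \<open>y = b * s * y\<close> leaves \<open>b\<close> on the left and \<open>c\<close> on the
  right. Hence restricting (ii) to \<open>sandwich b c\<close> loses no inverse.\<close>

lemma is_bc_inverse_in_sandwich:
  assumes "is_bc_inverse b c a y"
  shows "y \<in> sandwich b c"
proof -
  obtain s where s: "y = b * s * y"
    using assms by (auto simp: is_bc_inverse_def sandwich_def)
  obtain r where r: "y = y * r * c"
    using assms by (auto simp: is_bc_inverse_def sandwich_def)
  have "y = b * s * (y * r * c)" using s r by simp
  then have "y = b * (s * y * r) * c" by (simp add: mult.assoc)
  then show ?thesis unfolding sandwich_def by blast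
qed

text \<open>In \<open>z = b * r * c\<close>, replacing \<open>c\<close> by \<open>c * a * z\<close>
  puts \<open>z\<close> into \<open>sandwich b z\<close>, and replacing \<open>b\<close> by
  \<open>z * a * b\<close> puts it into \<open>sandwich z c\<close>.\<close>

lemma is_bc_inverse_iff:
  assumes z: "z \<in> sandwich b c"
  shows "is_bc_inverse b c a z \<longleftrightarrow> b = z * a * b \<and> c = c * a * z"
proof
  assume eqs: "b = z * a * b \<and> c = c * a * z"
  obtain r where r: "z = b * r * c" using z by (auto simp: sandwich_def)
  have "z = b * r * (c * a * z)" using r eqs by simp
  then have left: "z = b * (r * c * a) * z" by (simp add: mult.assoc)
  have "z = (z * a * b) * r * c" using r eqs by simp
  then have right: "z = z * (a * b * r) * c" by (simp add: mult.assoc)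
  from left right eqs show "is_bc_inverse b c a z"
    unfolding is_bc_inverse_def sandwich_def by blast
qed (simp add: is_bc_inverse_def)

lemma idempotent_equations_iff:
  assumes g: "g \<in> inner_inverses b" and h: "h \<in> inner_inverses c" and z: "z \<in> sandwich b c"
  shows "b * g = z * h * c * a * b * g \<and> h * c = h * c * a * b * g * z
    \<longleftrightarrow> b = z * a * b \<and> c = c * a * z"
proof -
  have bgb: "b * g * b = b" and chc: "c * h * c = c"
    using g h by (simp_all add: inner_inverses_def)
  obtain r where r: "z = b * r * c" using z by (auto simp: sandwich_def)
  have "b * g * z = (b * g * b) * r * c" by (simp add: r mult.assoc)
  then have bgz: "b * g * z = z" by (simp add: bgb r)
  have "z * h * c = b * r * (c * h * c)" by (simp add: r mult.assoc)
  then have zhc: "z * h * c = z" by (simp add: chc r)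
  have eq1: "z * h * c * a * b * g = z * a * b * g" by (simp add: zhc)
  have "h * c * a * b * g * z = h * c * a * (b * g * z)" by (simp add: mult.assoc)
  then have eq2: "h * c * a * b * g * z = h * c * a * z" by (simp add: bgz)
  have iff1: "b * g = z * a * b * g \<longleftrightarrow> b = z * a * b"
  proof
    assume "b * g = z * a * b * g"
    then have "b * g * b = z * a * b * g * b" by simp
    then have "b * g * b = z * a * (b * g * b)" by (simp add: mult.assoc)
    then show "b = z * a * b" by (simp add: bgb)
  qed simp
  have iff2: "h * c = h * c * a * z \<longleftrightarrow> c = c * a * z"
  proof
    assume "h * c = h * c * a * z"
    then have "c * (h * c) = c * (h * c * a * z)" by (rule arg_cong)
    then have "c * h * c = (c * h * c) * a * z" by (simp only: mult.assoc[symmetric])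
    then show "c = c * a * z" by (simp add: chc)
  next
    assume "c = c * a * z"
    \<comment> \<open>Unlike \<open>z * a * b\<close> in \<open>iff1\<close>, the product
      \<open>c * a * z\<close> is not a subterm of the left-nested \<open>h * c * a * z\<close>, so
      \<open>h\<close> is put in front and the product is rebracketed.\<close>
    then have "h * c = h * (c * a * z)" by (rule arg_cong)
    then show "h * c = h * c * a * z" by (simp only: mult.assoc[symmetric])
  qed
  show ?thesis by (simp only: eq1 eq2 iff1 iff2)
qed

theorem theorem4p1:
  fixes a b c g h :: "'a::{ring,monoid_mult}"
  assumes "regular b" and "regular c"
    and "g \<in> inner_inverses b" and "h \<in> inner_inverses c"
  shows "(bc_invertible b c a \<longleftrightarrow>
            (\<exists>z \<in> sandwich b c.
               b * g = z * h * c * a * b * g \<and> h * c = h * c * a * b * g * z)) \<and>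
         (\<forall>z \<in> sandwich b c.
            b * g = z * h * c * a * b * g \<and> h * c = h * c * a * b * g * z
              \<longrightarrow> z = bc_inverse b c a)"
proof -
  \<comment> \<open>The solutions of (ii) in \<open>sandwich b c\<close> are exactly the inverses of
    \<open>a\<close> along \<open>b\<close> and \<open>c\<close>; existence gives the equivalence,
    uniqueness the final claim.\<close>
  have key: "b * g = z * h * c * a * b * g \<and> h * c = h * c * a * b * g * z
      \<longleftrightarrow> is_bc_inverse b c a z" if "z \<in> sandwich b c" for z
    using idempotent_equations_iff[OF assms(3,4) that] is_bc_inverse_iff[OF that] by blast
  show ?thesis
    unfolding bc_invertible_def
    using key is_bc_inverse_in_sandwich bc_inverse_eqI by metis
qed

end
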